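(* Let $\alpha$ be a left-c.e. real, let $\beta$ be a Martin-Löf random left-c.e. real, and let $d \ge 0$ be a real constant. Then the following two statements are equivalent. (i) For all left-c.e. approximations $a_0,a_1,\dots$ of $\alpha$ and $b_0,b_1,\dots$ of $\beta$, it holds that $$\lim_{n\to\infty}\frac{\alpha-a_n}{\beta-b_n}=d;$$ moreover, $d=0$ if and only if $\alpha$ is not Martin-Löf random. (ii) For every nondecreasing translation function $g$ from $\beta$ to $\alpha$, it holds that $$\lim_{q\nearrow\beta}\frac{\alpha-g(q)}{\beta-q}=d;$$ moreover, $d=0$ if and only if $\alpha$ is not Martin-Löf random.
   Context: All rational and real numbers ($\alpha$, $\beta$, members of approximations, arguments and values of $g$) are in the unit interval $[0,1)$. The notation $\lim_{q\nearrow\beta}$ denotes the left limit, where $q$ ranges over rationals $q<\beta$ in $[0,1)$. A left-c.e. approximation of a real $\alpha$ is a nondecreasing (not necessarily strictly increasing) computable sequence of rational numbers that converges to $\alpha$. A real is left-c.e. if it is the limit of some left-c.e. approximation. A translation function from a real $\beta$ to a real $\alpha$ is a partially computable function $g$ from the set $\mathbb{Q}\cap[0,1)$ to itself such that, for all rationals $q \in [0,1)$ with $q<\beta$, the value $g(q)$ is defined and fulfills $g(q)<\alpha$, and such that $\lim_{q\nearrow\beta} g(q)=\alpha$. It is nondecreasing if $g(p)\le g(q)$ for all $p\le q$ in its domain. A real $\beta$ is Martin-Löf random if for every Martin-Löf test, i.e., every uniformly computably enumerable sequence $S_0,S_1,\dots$ of sets of intervals with rational endpoints such that for every $i$ the sum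 of the lengths of the intervals in $S_i$ is at most $2^{-(i+1)}$, there is some $i$ such that $\beta$ is in no interval of $S_i$. *)

theory Defs
  imports "HOL-Analysis.Analysis" "HOL-Library.Nat_Bijection" "HOL-Library.Countable"
begin

(* Kleene's partial recursive functions in unary form: several arguments are passed as one
   number through the Cantor pairing prod_encode, so the projections are the components of
   prod_decode. None means "undefined". *)

inductive partial_recursive :: "(nat \<rightharpoonup> nat) \<Rightarrow> bool" where
  zero: "partial_recursive (\<lambda>n. Some 0)"
| succ: "partial_recursive (\<lambda>n. Some (Suc n))"
| left: "partial_recursive (\<lambda>n. Some (fst (prod_decode n)))"
| right: "partial_recursive (\<lambda>n. Some (snd (prod_decode n)))"
| pair: "partial_recursive f \<Longrightarrow> partial_recursive g \<Longrightarrow>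
    partial_recursive
      (\<lambda>n. Option.bind (f n) (\<lambda>x. Option.bind (g n) (\<lambda>y. Some (prod_encode (x, y)))))"
| comp: "partial_recursive f \<Longrightarrow> partial_recursive g \<Longrightarrow> partial_recursive (f \<circ>\<^sub>m g)"
| prim_rec: "partial_recursive f \<Longrightarrow> partial_recursive g \<Longrightarrow>
    partial_recursive
      (\<lambda>n. rec_nat (f (fst (prod_decode n)))
             (\<lambda>m r. Option.bind r
                (\<lambda>v. g (prod_encode (fst (prod_decode n), prod_encode (m, v)))))
             (snd (prod_decode n)))"
| minimization: "partial_recursive f \<Longrightarrow>
    partial_recursive
      (\<lambda>x. if \<exists>n. f (prod_encode (x, n)) = Some 0 \<and> (\<forall>m<n. f (prod_encode (x, m)) \<noteq> None)
           then Some (LEAST n. f (prod_encode (x, n)) = Some 0)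
           else None)"

(* Rationals are named through the surjection nat_to_rat_surj, which reads a number as a
   numerator/denominator pair of integers. Names are not unique; computability of a function
   on rationals means that a partial recursive function turns every name of an argument into
   some name of the value, and diverges when there is no value. *)

definition computable_rat_seq :: "(nat \<Rightarrow> rat) \<Rightarrow> bool" where
  "computable_rat_seq a \<longleftrightarrow>
     (\<exists>f. partial_recursive (\<lambda>n. Some (f n)) \<and> (\<forall>n. a n = nat_to_rat_surj (f n)))"

definition partially_computable_rat :: "(rat \<rightharpoonup> rat) \<Rightarrow> bool" where
  "partially_computable_rat g \<longleftrightarrow>
     (\<exists>f. partial_recursive f \<and>
        (\<forall>c. map_option nat_to_rat_surj (f c) = g (nat_to_rat_surj c)))"

definition left_ce_approx :: "(nat \<Rightarrow> rat) \<Rightarrow> real \<Rightarrow> bool" where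
  "left_ce_approx a \<alpha> \<longleftrightarrow>
     range a \<subseteq> {0..<1} \<and> mono a \<and> computable_rat_seq a \<and>
     (\<lambda>n. real_of_rat (a n)) \<longlonglongrightarrow> \<alpha>"

definition left_ce :: "real \<Rightarrow> bool" where
  "left_ce \<alpha> \<longleftrightarrow> (\<exists>a. left_ce_approx a \<alpha>)"

definition rats_at_left :: "real \<Rightarrow> rat filter" where
  "rats_at_left \<beta> = inf (filtercomap real_of_rat (at_left \<beta>)) (principal {0..<1})"

definition translation_function :: "(rat \<rightharpoonup> rat) \<Rightarrow> real \<Rightarrow> real \<Rightarrow> bool" where
  "translation_function g \<beta> \<alpha> \<longleftrightarrow>
     dom g \<subseteq> {0..<1} \<and> ran g \<subseteq> {0..<1} \<and> partially_computable_rat g \<and>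
     (\<forall>q\<in>{0..<1}. real_of_rat q < \<beta> \<longrightarrow> (\<exists>r. g q = Some r \<and> real_of_rat r < \<alpha>)) \<and>
     ((\<lambda>q. real_of_rat (the (g q))) \<longlongrightarrow> \<alpha>) (rats_at_left \<beta>)"

definition nondecreasing_fun :: "(rat \<rightharpoonup> rat) \<Rightarrow> bool" where
  "nondecreasing_fun g \<longleftrightarrow> (\<forall>p\<in>dom g. \<forall>q\<in>dom g. p \<le> q \<longrightarrow> the (g p) \<le> the (g q))"

(* A numbering of all bounded intervals with rational endpoints, with either endpoint
   included or excluded; codes whose endpoints are in the wrong order name the empty set. *)

definition rat_interval :: "nat \<Rightarrow> real set" where
  "rat_interval n =
     (let (k, m) = prod_decode n;
          (i, j) = prod_decode m;
          l = real_of_rat (nat_to_rat_surj i);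
          u = real_of_rat (nat_to_rat_surj j)
      in if k = 0 then {l<..<u} else if k = 1 then {l..u}
         else if k = 2 then {l..<u} else {l<..u})"

definition uniformly_ce_intervals :: "(nat \<Rightarrow> real set set) \<Rightarrow> bool" where
  "uniformly_ce_intervals S \<longleftrightarrow>
     (\<exists>f. partial_recursive f \<and>
        (\<forall>i. S i = rat_interval ` {n. f (prod_encode (i, n)) \<noteq> None}))"

(* The sum is taken in ennreal, so a divergent sum is infinite rather than 0. *)

definition martin_loef_test :: "(nat \<Rightarrow> real set set) \<Rightarrow> bool" where
  "martin_loef_test S \<longleftrightarrow>
     uniformly_ce_intervals S \<and>
     (\<forall>i. (\<Sum>\<^sub>\<infinity>I\<in>S i. emeasure lborel I) \<le> ennreal ((1 / 2) ^ (i + 1)))"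

definition martin_loef_random :: "real \<Rightarrow> bool" where
  "martin_loef_random \<beta> \<longleftrightarrow> (\<forall>S. martin_loef_test S \<longrightarrow> (\<exists>i. \<forall>I\<in>S i. \<beta> \<notin> I))"

end

theory Submission imports Defs begin

text \<open>
  The two limits are compared by passing back and forth between approximations and translation
  functions. Each passage displaces the index a little, and the freedom to choose the
  approximations or the translation function absorbs this displacement. That the limit exists for
  some pair is never shown: both sides of the equivalence are universal statements, and each
  instance of one is squeezed between two instances of the other.

  From (i) to (ii): if \<open>b\<close> approximates \<open>\<beta>\<close> and \<open>g\<close> is a nondecreasing translation function, then
  \<open>g \<circ> b\<close> approximates \<open>\<alpha>\<close>. A rational \<open>q\<close> slightly below \<open>\<beta>\<close> lies in some
  \<open>[b n, b (n + 1))\<close>, and by monotonicity the quotient at \<open>q\<close> lies between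
  \<open>(\<alpha> - g (b (n + 1))) / (\<beta> - b n)\<close> and \<open>(\<alpha> - g (b n)) / (\<beta> - b (n + 1))\<close>. A shifted
  approximation is again one, so (i) applies to both bounds
  (lemma \<open>translation_ratio_tendsto\<close>).

  From (ii) to (i): given approximations \<open>a\<close> and \<open>b\<close>, send \<open>q\<close> to \<open>a n\<close> for the first \<open>n\<close> with
  \<open>q \<le> b n\<close>, or alternatively with \<open>q < b n\<close>. Both are nondecreasing translation functions, and
  \<open>a n\<close> lies between their values at \<open>b n\<close>. Hence the quotient at \<open>n\<close> lies between two
  quotients to which (ii) applies (lemma \<open>approx_ratio_tendsto\<close>).

  Randomness enters only through irrationality: a rational is covered by the test consisting
  of its own one-point interval. So \<open>\<beta>\<close> is never reached by its approximations and no
  denominator vanishes. The second passage also needs \<open>a n < \<alpha>\<close>, since a translation function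
  has values strictly below \<open>\<alpha>\<close>. If \<open>a\<close> does reach \<open>\<alpha>\<close>, then \<open>\<alpha>\<close> is rational, hence not random,
  the clause about \<open>d\<close> gives \<open>d = 0\<close>, and the quotients are eventually \<open>0\<close>.

  The remaining work is computability: the search for the first \<open>n\<close> requires that the order of
  rationals be decidable on names.
\<close>

section \<open>Total recursive functions and decidable predicates\<close>

definition recursive :: "(nat \<Rightarrow> nat) \<Rightarrow> bool" where
  "recursive f \<longleftrightarrow> partial_recursive (\<lambda>n. Some (f n))"

text \<open>
  The value \<open>0\<close> stands for truth because minimization searches for zeros.
\<close>

definition decidable :: "(nat \<Rightarrow> bool) \<Rightarrow> bool" where
  "decidable P \<longleftrightarrow> recursive (\<lambda>n. if P n then 0 else 1)"

lemma partial_recursive_comp_recursive: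
  assumes "partial_recursive f" "recursive g"
  shows "partial_recursive (\<lambda>n. f (g n))"
  using partial_recursive.comp[OF assms(1) assms(2)[unfolded recursive_def]]
  by (simp add: map_comp_def)

lemma recursive_comp:
  assumes "recursive f" "recursive g"
  shows "recursive (\<lambda>n. f (g n))"
  using partial_recursive_comp_recursive[OF _ assms(2)] assms(1) unfolding recursive_def by blast

lemma recursive_Suc: "recursive f \<Longrightarrow> recursive (\<lambda>n. Suc (f n))"
  by (rule recursive_comp[of Suc]) (simp_all add: recursive_def partial_recursive.succ)

lemma recursive_fst: "recursive f \<Longrightarrow> recursive (\<lambda>n. fst (prod_decode (f n)))"
  by (rule recursive_comp[of "\<lambda>n. fst (prod_decode n)"])
    (simp_all add: recursive_def partial_recursive.left)

lemma recursive_snd: "recursive f \<Longrightarrow> recursive (\<lambda>n. snd (prod_decode (f n)))"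
  by (rule recursive_comp[of "\<lambda>n. snd (prod_decode n)"])
    (simp_all add: recursive_def partial_recursive.right)

lemma recursive_pair:
  "recursive f \<Longrightarrow> recursive g \<Longrightarrow> recursive (\<lambda>n. prod_encode (f n, g n))"
  unfolding recursive_def by (drule (1) partial_recursive.pair) simp

lemma recursive_id: "recursive (\<lambda>n. n)"
  unfolding recursive_def
  using partial_recursive.pair[OF partial_recursive.left partial_recursive.right] by simp

lemma recursive_const: "recursive (\<lambda>n. k)"
proof (induction k)
  case 0
  show ?case unfolding recursive_def by (rule partial_recursive.zero)
qed (rule recursive_Suc)

text \<open>
  Along total functions the option-valued recursor of the definition never meets \<open>None\<close>, so
  it agrees with the plain recursor. The step function receives parameter, counter and previous
  value as one nested pair.
\<close>

lemma recursive_rec_nat: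
  assumes "recursive f"
    and "recursive (\<lambda>t. g (fst (prod_decode t)) (fst (prod_decode (snd (prod_decode t))))
                          (snd (prod_decode (snd (prod_decode t)))))"
    and "recursive h" "recursive k"
  shows "recursive (\<lambda>n. rec_nat (f (h n)) (g (h n)) (k n))"
proof -
  have *: "rec_nat (Some (f x)) (\<lambda>m r. Option.bind r (\<lambda>v. Some (g x m v))) j
    = Some (rec_nat (f x) (g x) j)" for x j
    by (induction j) auto
  have "recursive (\<lambda>n. rec_nat (f (fst (prod_decode n))) (g (fst (prod_decode n)))
      (snd (prod_decode n)))"
    using partial_recursive.prim_rec[OF assms(1,2)[unfolded recursive_def]]
    unfolding recursive_def by (simp add: *)
  from recursive_comp[OF this recursive_pair[OF assms(3,4)]] show ?thesis by simp
qed

lemma recursive_add: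
  assumes "recursive f" "recursive g"
  shows "recursive (\<lambda>n. f n + g n)"
proof -
  have "rec_nat x (\<lambda>m. Suc) j = x + j" for x j by (induction j) auto
  with recursive_rec_nat[of "\<lambda>x. x" "\<lambda>x m. Suc", OF _ _ assms] show ?thesis
    by (simp add: recursive_id recursive_snd recursive_Suc)
qed

lemma recursive_mult:
  assumes "recursive f" "recursive g"
  shows "recursive (\<lambda>n. f n * g n)"
proof -
  have "rec_nat 0 (\<lambda>m v. v + x) j = x * j" for x j :: nat by (induction j) auto
  with recursive_rec_nat[of "\<lambda>x. 0" "\<lambda>x m v. v + x", OF _ _ assms] show ?thesis
    by (simp add: recursive_id recursive_const recursive_fst recursive_snd recursive_add)
qed

lemma recursive_pred:
  assumes "recursive f"
  shows "recursive (\<lambda>n. f n - 1)"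
proof -
  have "rec_nat 0 (\<lambda>m v. m) j = j - 1" for j :: nat by (induction j) auto
  with recursive_rec_nat[of "\<lambda>x. 0" "\<lambda>x m v. m", OF _ _ assms assms] show ?thesis
    by (simp add: recursive_id recursive_const recursive_fst recursive_snd)
qed

lemma recursive_diff:
  assumes "recursive f" "recursive g"
  shows "recursive (\<lambda>n. f n - g n)"
proof -
  have "rec_nat x (\<lambda>m v. v - 1) j = x - j" for x j :: nat by (induction j) auto
  with recursive_rec_nat[of "\<lambda>x. x" "\<lambda>x m v. v - 1", OF _ _ assms] show ?thesis
    using recursive_pred[OF recursive_snd[OF recursive_snd[OF recursive_id]]]
    by (simp add: recursive_id)
qed

lemma recursive_mod2:
  assumes "recursive f"
  shows "recursive (\<lambda>n. f n mod 2)"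
proof -
  have "rec_nat 0 (\<lambda>m v. 1 - v) j = j mod 2" for j :: nat by (induction j) (auto, presburger)
  with recursive_rec_nat[of "\<lambda>x. 0" "\<lambda>x m v. 1 - v", OF _ _ assms assms] show ?thesis
    using recursive_diff[OF recursive_const[of 1] recursive_snd[OF recursive_snd[OF recursive_id]]]
    by (simp add: recursive_const)
qed

lemma recursive_div2:
  assumes "recursive f"
  shows "recursive (\<lambda>n. f n div 2)"
proof -
  have "rec_nat 0 (\<lambda>m v. v + m mod 2) j = j div 2" for j :: nat by (induction j) (auto, presburger)
  with recursive_rec_nat[of "\<lambda>x. 0" "\<lambda>x m v. v + m mod 2", OF _ _ assms assms] show ?thesis
    by (simp add: recursive_id recursive_const recursive_fst recursive_snd recursive_add
        recursive_mod2)
qed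

lemmas recursive_intros =
  recursive_const recursive_id recursive_Suc recursive_fst recursive_snd recursive_pair
  recursive_add recursive_mult recursive_diff recursive_mod2 recursive_div2

lemma decidable_le:
  assumes "recursive f" "recursive g"
  shows "decidable (\<lambda>n. f n \<le> g n)"
proof -
  \<comment> \<open>\<open>1 - x\<close> on natural numbers is the zero test, so nesting it twice gives the sign.\<close>
  have "recursive (\<lambda>n. 1 - (1 - (f n - g n)))"
    using assms by (intro recursive_intros)
  moreover have "1 - (1 - (f n - g n)) = (if f n \<le> g n then 0 else 1)" for n by simp
  ultimately show ?thesis by (simp only: decidable_def)
qed

lemma decidable_not:
  assumes "decidable P"
  shows "decidable (\<lambda>n. \<not> P n)"
proof -
  have "recursive (\<lambda>n. 1 - (if P n then 0 else 1))"
    using assms unfolding decidable_def by (intro recursive_intros)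
  moreover have "1 - (if P n then 0 else 1) = (if \<not> P n then 0 else 1 :: nat)" for n by simp
  ultimately show ?thesis by (simp only: decidable_def)
qed

lemma decidable_conj:
  assumes "decidable P" "decidable Q"
  shows "decidable (\<lambda>n. P n \<and> Q n)"
proof -
  have "recursive (\<lambda>n. 1 - (1 - (if P n then 0 else 1)) * (1 - (if Q n then 0 else 1)))"
    using assms unfolding decidable_def by (intro recursive_intros)
  moreover have "1 - (1 - (if P n then 0 else 1)) * (1 - (if Q n then 0 else 1))
      = (if P n \<and> Q n then 0 else 1 :: nat)" for n by simp
  ultimately show ?thesis by (simp only: decidable_def)
qed

lemma partial_recursive_Least:
  assumes "decidable (\<lambda>t. P (fst (prod_decode t)) (snd (prod_decode t)))"
  shows "partial_recursive (\<lambda>x. if \<exists>n. P x n then Some (LEAST n. P x n) else None)"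
proof -
  have "Some (if P x n then 0 else 1 :: nat) = Some 0 \<longleftrightarrow> P x n" for x n by simp
  with partial_recursive.minimization[OF assms[unfolded decidable_def recursive_def]]
  show ?thesis by (simp only: prod_encode_inverse fst_conv snd_conv) simp
qed

section \<open>Comparing names of rationals\<close>

text \<open>
  A name is a pair of codes of integers, possibly with a negative or zero second component. To
  stay within natural numbers, an integer is split into positive and negative part, and a
  quotient \<open>A / B\<close> is rewritten as \<open>(A * B) / (B * B)\<close>, whose denominator has no sign; the
  numerator \<open>A * B\<close> is again a difference of natural numbers. Comparing two such fractions is
  then a polynomial inequality between natural numbers.
\<close>

definition int_pos_part :: "nat \<Rightarrow> nat" where
  "int_pos_part c = (1 - c mod 2) * (c div 2)"

definition int_neg_part :: "nat \<Rightarrow> nat" where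
  "int_neg_part c = (c mod 2) * Suc (c div 2)"

lemma int_decode_eq_parts: "int_decode c = int (int_pos_part c) - int (int_neg_part c)"
  unfolding int_decode_def sum_decode_def int_pos_part_def int_neg_part_def
  by (cases "even c") (auto simp: even_iff_mod_2_eq_zero odd_iff_mod_2_eq_one)

definition rat_pos_num :: "nat \<Rightarrow> nat" where
  "rat_pos_num c = (let a = fst (prod_decode c); b = snd (prod_decode c)
     in int_pos_part a * int_pos_part b + int_neg_part a * int_neg_part b)"

definition rat_neg_num :: "nat \<Rightarrow> nat" where
  "rat_neg_num c = (let a = fst (prod_decode c); b = snd (prod_decode c)
     in int_pos_part a * int_neg_part b + int_neg_part a * int_pos_part b)"

text \<open>
  The summand \<open>1 - s\<close> replaces the denominator \<open>0\<close> by \<open>1\<close>. A name with denominator \<open>0\<close>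
  denotes \<open>0\<close>, and its numerator \<open>A * B\<close> vanishes, so the value is preserved.
\<close>

definition rat_den :: "nat \<Rightarrow> nat" where
  "rat_den c = (let b = snd (prod_decode c);
                    s = int_pos_part b * int_pos_part b + int_neg_part b * int_neg_part b
     in s + (1 - s))"

lemma rat_den_pos: "rat_den c > 0"
  unfolding rat_den_def Let_def by linarith

lemma nat_to_rat_surj_eq_parts:
  "nat_to_rat_surj c = (of_nat (rat_pos_num c) - of_nat (rat_neg_num c)) / of_nat (rat_den c)"
proof -
  define a b where "a = fst (prod_decode c)" and "b = snd (prod_decode c)"
  define A B where "A = int_decode a" and "B = int_decode b"
  have num: "(of_nat (rat_pos_num c) - of_nat (rat_neg_num c) :: rat) = of_int (A * B)"
    unfolding A_def B_def int_decode_eq_parts rat_pos_num_def rat_neg_num_def Let_def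
      a_def[symmetric] b_def[symmetric]
    by (simp add: algebra_simps)
  have c: "nat_to_rat_surj c = of_int A / of_int B"
    unfolding nat_to_rat_surj_def A_def B_def a_def b_def
    by (simp add: case_prod_beta Fract_of_int_quotient)
  have zero: "int_pos_part b = 0 \<or> int_neg_part b = 0"
    unfolding int_pos_part_def int_neg_part_def by auto
  show ?thesis
  proof (cases "B = 0")
    case True
    then show ?thesis using c num by simp
  next
    case False
    have "rat_den c = int_pos_part b * int_pos_part b + int_neg_part b * int_neg_part b"
      using False zero unfolding B_def int_decode_eq_parts rat_den_def Let_def b_def[symmetric]
      by (cases "int_pos_part b"; cases "int_neg_part b") auto
    then have "int (rat_den c) = B * B"
      using zero unfolding B_def int_decode_eq_parts by auto
    then have "(of_nat (rat_den c) :: rat) = of_int B * of_int B"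
      by (metis of_int_mult of_int_of_nat_eq)
    with False show ?thesis unfolding c num by simp
  qed
qed

lemma recursive_rat_parts:
  assumes "recursive f"
  shows "recursive (\<lambda>n. rat_pos_num (f n))" "recursive (\<lambda>n. rat_neg_num (f n))"
    "recursive (\<lambda>n. rat_den (f n))"
  unfolding rat_pos_num_def rat_neg_num_def rat_den_def Let_def int_pos_part_def int_neg_part_def
  using assms by (intro recursive_intros; assumption)+

lemma decidable_rat_le:
  assumes "recursive f" "recursive g"
  shows "decidable (\<lambda>n. nat_to_rat_surj (f n) \<le> nat_to_rat_surj (g n))"
proof -
  have "nat_to_rat_surj x \<le> nat_to_rat_surj y \<longleftrightarrow>
     rat_pos_num x * rat_den y + rat_neg_num y * rat_den x
       \<le> rat_pos_num y * rat_den x + rat_neg_num x * rat_den y" for x y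
  proof -
    have "nat_to_rat_surj x \<le> nat_to_rat_surj y \<longleftrightarrow>
       (of_nat (rat_pos_num x) - of_nat (rat_neg_num x)) * of_nat (rat_den y)
        \<le> (of_nat (rat_pos_num y) - of_nat (rat_neg_num y)) * (of_nat (rat_den x) :: rat)"
      unfolding nat_to_rat_surj_eq_parts
      using rat_den_pos[of x] rat_den_pos[of y] by (simp add: divide_simps mult.commute)
    also have "\<dots> \<longleftrightarrow>
      (of_nat (rat_pos_num x * rat_den y + rat_neg_num y * rat_den x) :: rat)
       \<le> of_nat (rat_pos_num y * rat_den x + rat_neg_num x * rat_den y)"
      by (simp add: algebra_simps)
    finally show ?thesis by (simp only: of_nat_le_iff)
  qed
  then show ?thesis
    using assms by (auto intro!: decidable_le recursive_intros recursive_rat_parts)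
qed

lemma decidable_rat_less:
  assumes "recursive f" "recursive g"
  shows "decidable (\<lambda>n. nat_to_rat_surj (f n) < nat_to_rat_surj (g n))"
  using decidable_not[OF decidable_rat_le[OF assms(2,1)]] by (simp add: not_le)

section \<open>Random reals are irrational\<close>

text \<open>
  The closed interval \<open>{r..r}\<close> has length zero and rational endpoints, so it can serve as the only
  interval at every level of a test.
\<close>

lemma not_martin_loef_random_of_rat: "\<not> martin_loef_random (real_of_rat r)"
proof
  assume random: "martin_loef_random (real_of_rat r)"
  obtain j where j: "r = nat_to_rat_surj j"
    using surj_nat_to_rat_surj by (metis surjD)
  \<comment> \<open>The tag \<open>1\<close> selects closed intervals.\<close>
  define c where "c = prod_encode (1, prod_encode (j, j))"
  have c: "rat_interval c = {real_of_rat r}"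
    unfolding rat_interval_def c_def by (simp add: j)
  \<comment> \<open>The minimized predicate ignores the search variable, so the search halts at once on
    the code \<open>c\<close> and diverges on every other one.\<close>
  define f where "f = (\<lambda>x. if \<exists>n::nat. snd (prod_decode x) \<le> c \<and> c \<le> snd (prod_decode x)
     then Some (LEAST n::nat. snd (prod_decode x) \<le> c \<and> c \<le> snd (prod_decode x)) else None)"
  have "partial_recursive f"
    unfolding f_def
    by (intro partial_recursive_Least decidable_conj decidable_le recursive_intros)
  moreover have "{n. f (prod_encode (i, n)) \<noteq> None} = {c}" for i
    unfolding f_def by auto
  ultimately have "uniformly_ce_intervals (\<lambda>i. {rat_interval c})"
    unfolding uniformly_ce_intervals_def by (intro exI[of _ f]) simp
  then have "martin_loef_test (\<lambda>i. {rat_interval c})"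
    unfolding martin_loef_test_def by (simp add: c)
  with random show False
    unfolding martin_loef_random_def by (auto simp: c)
qed

section \<open>Approximating a real from the left\<close>

lemma eventually_rats_at_left:
  "eventually P (rats_at_left \<beta>) \<longleftrightarrow>
     (\<exists>l<\<beta>. \<forall>q\<in>{0..<1}. l < real_of_rat q \<and> real_of_rat q < \<beta> \<longrightarrow> P q)"
    (is "?L \<longleftrightarrow> ?R")
proof
  assume ?L
  then obtain Q l where "l < \<beta>" "\<And>y. l < y \<Longrightarrow> y < \<beta> \<Longrightarrow> Q y"
    "\<And>q. Q (real_of_rat q) \<Longrightarrow> q \<in> {0..<1} \<Longrightarrow> P q"
    unfolding rats_at_left_def eventually_inf_principal eventually_filtercomap
      eventually_at_left_field by auto
  then show ?R by blast
next
  assume ?R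
  then obtain l where "l < \<beta>"
    "\<And>q. q \<in> {0..<1} \<Longrightarrow> l < real_of_rat q \<Longrightarrow> real_of_rat q < \<beta> \<Longrightarrow> P q"
    by blast
  then show ?L
    unfolding rats_at_left_def eventually_inf_principal eventually_filtercomap
      eventually_at_left_field
    by (intro exI[of _ "\<lambda>x. l < x \<and> x < \<beta>"] conjI exI[of _ l]) auto
qed

lemma left_ce_approx_range: "left_ce_approx a \<alpha> \<Longrightarrow> a n \<in> {0..<1}"
  unfolding left_ce_approx_def by blast

lemma left_ce_approx_mono: "left_ce_approx a \<alpha> \<Longrightarrow> m \<le> n \<Longrightarrow> a m \<le> a n"
  by (auto simp: left_ce_approx_def mono_def)

lemma left_ce_approx_eventually_greater:
  assumes "left_ce_approx a \<alpha>" "y < \<alpha>"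
  shows "\<exists>N. \<forall>n\<ge>N. y < real_of_rat (a n)"
proof -
  have "(\<lambda>n. real_of_rat (a n)) \<longlonglongrightarrow> \<alpha>"
    using assms(1) by (simp add: left_ce_approx_def)
  from order_tendstoD(1)[OF this assms(2)] show ?thesis
    by (simp add: eventually_sequentially)
qed

lemma left_ce_approx_le:
  assumes "left_ce_approx a \<alpha>"
  shows "real_of_rat (a n) \<le> \<alpha>"
proof -
  have "incseq (\<lambda>n. real_of_rat (a n))"
    using left_ce_approx_mono[OF assms] by (auto simp: mono_def of_rat_less_eq)
  then show ?thesis
    using assms incseq_le by (auto simp: left_ce_approx_def)
qed

lemma left_ce_approx_less_random:
  assumes "left_ce_approx b \<beta>" "martin_loef_random \<beta>"
  shows "real_of_rat (b n) < \<beta>"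
  using left_ce_approx_le[OF assms(1), of n] not_martin_loef_random_of_rat[of "b n"] assms(2)
  by (cases "real_of_rat (b n) = \<beta>") auto

lemma left_ce_approx_Suc:
  assumes "left_ce_approx a \<alpha>"
  shows "left_ce_approx (\<lambda>n. a (Suc n)) \<alpha>"
proof -
  obtain f where f: "recursive f" "\<And>n. a n = nat_to_rat_surj (f n)"
    using assms by (auto simp: left_ce_approx_def computable_rat_seq_def recursive_def)
  have "computable_rat_seq (\<lambda>n. a (Suc n))"
    unfolding computable_rat_seq_def recursive_def[symmetric]
    using recursive_comp[OF f(1) recursive_Suc[OF recursive_id]] f(2) by blast
  then show ?thesis
    using assms LIMSEQ_Suc[of "\<lambda>n. real_of_rat (a n)"]
    by (auto simp: left_ce_approx_def mono_def)
qed

lemma filterlim_rats_at_left: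
  assumes "left_ce_approx b \<beta>" "\<And>n. real_of_rat (b n) < \<beta>"
  shows "filterlim b (rats_at_left \<beta>) sequentially"
proof (subst filterlim_iff, intro allI impI)
  fix P assume "eventually P (rats_at_left \<beta>)"
  then obtain l where l: "l < \<beta>"
    "\<And>q. q \<in> {0..<1} \<Longrightarrow> l < real_of_rat q \<Longrightarrow> real_of_rat q < \<beta> \<Longrightarrow> P q"
    unfolding eventually_rats_at_left by blast
  obtain N where N: "\<And>n. n \<ge> N \<Longrightarrow> l < real_of_rat (b n)"
    using left_ce_approx_eventually_greater[OF assms(1) l(1)] by blast
  then show "eventually (\<lambda>n. P (b n)) sequentially"
    using l(2) left_ce_approx_range[OF assms(1)] assms(2)
    unfolding eventually_sequentially by blast
qed

text \<open>
  The intervals between consecutive members of an approximation cover everything from \<open>b N\<close> up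
  to \<open>\<beta>\<close>. Choosing \<open>n + 1\<close> as the first index beyond \<open>q\<close> makes this work even where \<open>b\<close> is
  constant.
\<close>

lemma left_ce_approx_bracket:
  assumes "left_ce_approx b \<beta>" "b N \<le> q" "real_of_rat q < \<beta>"
  obtains n where "n \<ge> N" "b n \<le> q" "q < b (Suc n)"
proof -
  obtain k where "real_of_rat q < real_of_rat (b k)"
    using left_ce_approx_eventually_greater[OF assms(1,3)] by (meson order_refl)
  then have k: "q < b k" by (simp add: of_rat_less)
  define m where "m = (LEAST m. q < b m)"
  have m: "q < b m" unfolding m_def using k by (rule LeastI)
  have "N < m"
    using left_ce_approx_mono[OF assms(1), of m N] assms(2) m by (meson leD le_less_trans not_le)
  then obtain n where n: "m = Suc n" "n \<ge> N"
    by (cases m) auto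
  have "\<not> q < b n" using n not_less_Least[of n "\<lambda>m. q < b m"] unfolding m_def[symmetric] by auto
  with n m that show thesis by auto
qed

section \<open>From approximations to translation functions\<close>

text \<open>
  Every \<open>b n\<close> lies below \<open>\<beta>\<close>, where \<open>g\<close> converges, so composing the names of \<open>b\<close> with the
  algorithm for \<open>g\<close> gives a total recursive function although \<open>g\<close> itself is partial.
\<close>

lemma translation_function_image_approx:
  assumes g: "translation_function g \<beta> \<alpha>" "nondecreasing_fun g"
    and b: "left_ce_approx b \<beta>" "\<And>n. real_of_rat (b n) < \<beta>"
  shows "left_ce_approx (\<lambda>n. the (g (b n))) \<alpha>"
proof -
  have b01: "b n \<in> {0..<1}" for n
    by (rule left_ce_approx_range[OF b(1)])
  have gb: "\<exists>r. g (b n) = Some r" for n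
    using g(1) b01 b(2) unfolding translation_function_def by blast
  have "range (\<lambda>n. the (g (b n))) \<subseteq> {0..<1}"
  proof safe
    fix n
    show "the (g (b n)) \<in> {0..<1}"
      using gb[of n] g(1) unfolding translation_function_def by (auto intro: ranI)
  qed
  moreover have "mono (\<lambda>n. the (g (b n)))"
  proof (rule monoI)
    fix m n :: nat assume "m \<le> n"
    then have "b m \<le> b n" by (rule left_ce_approx_mono[OF b(1)])
    then show "the (g (b m)) \<le> the (g (b n))"
      using g(2) gb[of m] gb[of n] unfolding nondecreasing_fun_def by (simp add: dom_def)
  qed
  moreover have "computable_rat_seq (\<lambda>n. the (g (b n)))"
  proof -
    obtain h where h: "recursive h" "\<And>n. b n = nat_to_rat_surj (h n)"
      using b(1) by (auto simp: left_ce_approx_def computable_rat_seq_def recursive_def)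
    obtain f where f: "partial_recursive f"
      "\<And>c. map_option nat_to_rat_surj (f c) = g (nat_to_rat_surj c)"
      using g(1) by (auto simp: translation_function_def partially_computable_rat_def)
    have fh: "f (h n) = Some (the (f (h n)))" for n
      using f(2)[of "h n"] gb[of n] h(2)[of n] by (cases "f (h n)") auto
    have "recursive (\<lambda>n. the (f (h n)))"
      using partial_recursive_comp_recursive[OF f(1) h(1)] fh unfolding recursive_def by simp
    moreover have "the (g (b n)) = nat_to_rat_surj (the (f (h n)))" for n
      using f(2)[of "h n"] fh[of n] h(2)[of n] by (cases "f (h n)") (auto dest: sym)
    ultimately show ?thesis
      unfolding computable_rat_seq_def recursive_def[symmetric] by blast
  qed
  moreover have "(\<lambda>n. real_of_rat (the (g (b n)))) \<longlonglongrightarrow> \<alpha>"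
    using g(1) filterlim_compose[OF _ filterlim_rats_at_left[OF b]]
    unfolding translation_function_def by blast
  ultimately show ?thesis unfolding left_ce_approx_def by blast
qed

text \<open>
  The bounds \<open>lo\<close> and \<open>hi\<close> differ from the quotient along \<open>g \<circ> b\<close> and \<open>b\<close> by a shift of
  numerator or denominator. Applying the hypothesis to the shifted sequences avoids any
  comparison of \<open>\<beta> - b n\<close> with \<open>\<beta> - b (n + 1)\<close>.
\<close>

lemma translation_ratio_tendsto:
  assumes lim: "\<And>a b. left_ce_approx a \<alpha> \<Longrightarrow> left_ce_approx b \<beta> \<Longrightarrow>
      (\<lambda>n. (\<alpha> - real_of_rat (a n)) / (\<beta> - real_of_rat (b n))) \<longlonglongrightarrow> d"
    and g: "translation_function g \<beta> \<alpha>" "nondecreasing_fun g"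
    and b: "left_ce_approx b \<beta>" "\<And>n. real_of_rat (b n) < \<beta>"
  shows "((\<lambda>q. (\<alpha> - real_of_rat (the (g q))) / (\<beta> - real_of_rat q)) \<longlongrightarrow> d)
           (rats_at_left \<beta>)"
proof -
  let ?f = "\<lambda>q. (\<alpha> - real_of_rat (the (g q))) / (\<beta> - real_of_rat q)"
  define lo where
    "lo n = (\<alpha> - real_of_rat (the (g (b (Suc n))))) / (\<beta> - real_of_rat (b n))" for n
  define hi where
    "hi n = (\<alpha> - real_of_rat (the (g (b n)))) / (\<beta> - real_of_rat (b (Suc n)))" for n
  note a = translation_function_image_approx[OF g b]
  have lo: "lo \<longlonglongrightarrow> d"
    unfolding lo_def by (rule lim[OF left_ce_approx_Suc[OF a] b(1)])
  have hi: "hi \<longlonglongrightarrow> d"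
    unfolding hi_def by (rule lim[OF a left_ce_approx_Suc[OF b(1)]])
  have sandwich: "lo n \<le> ?f q \<and> ?f q \<le> hi n"
    if q: "q \<in> {0..<1}" "real_of_rat q < \<beta>" "b n \<le> q" "q < b (Suc n)" for n q
  proof -
    have dom: "p \<in> dom g \<and> real_of_rat (the (g p)) < \<alpha>"
      if "p \<in> {0..<1}" "real_of_rat p < \<beta>" for p
      using g(1) that unfolding translation_function_def by fastforce
    have b01: "b n \<in> {0..<1}" for n
    by (rule left_ce_approx_range[OF b(1)])
    have "the (g (b n)) \<le> the (g q)" "the (g q) \<le> the (g (b (Suc n)))"
      using g(2) dom[OF q(1,2)] dom[OF b01 b(2)] q(3,4) unfolding nondecreasing_fun_def
      by (auto intro: less_imp_le)
    then have "real_of_rat (the (g (b n))) \<le> real_of_rat (the (g q))"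
      "real_of_rat (the (g q)) \<le> real_of_rat (the (g (b (Suc n))))"
      "real_of_rat (b n) \<le> real_of_rat q" "real_of_rat q \<le> real_of_rat (b (Suc n))"
      using q by (auto simp: of_rat_less_eq)
    then show ?thesis
      unfolding lo_def hi_def
      using q(2) b(2)[of "Suc n"] b(2)[of n] dom[OF q(1,2)] dom[OF b01 b(2)]
      by (auto intro!: frac_le simp: less_imp_le)
  qed
  show ?thesis
  proof (rule order_tendstoI)
    fix y assume "y < d"
    then obtain N where N: "\<And>n. n \<ge> N \<Longrightarrow> y < lo n"
      using order_tendstoD(1)[OF lo] by (auto simp: eventually_sequentially)
    have "y < ?f q"
      if q: "q \<in> {0..<1}" "real_of_rat (b N) < real_of_rat q" "real_of_rat q < \<beta>" for q
    proof -
      have "b N \<le> q" using q(2) by (simp add: of_rat_less)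
      then obtain n where "n \<ge> N" "b n \<le> q" "q < b (Suc n)"
        using q(3) by (rule left_ce_approx_bracket[OF b(1)])
      with sandwich[OF q(1,3)] N[of n] show ?thesis by fastforce
    qed
    then show "eventually (\<lambda>q. y < ?f q) (rats_at_left \<beta>)"
      unfolding eventually_rats_at_left using b(2)[of N] by blast
  next
    fix y assume "d < y"
    then obtain N where N: "\<And>n. n \<ge> N \<Longrightarrow> hi n < y"
      using order_tendstoD(2)[OF hi] by (auto simp: eventually_sequentially)
    have "?f q < y"
      if q: "q \<in> {0..<1}" "real_of_rat (b N) < real_of_rat q" "real_of_rat q < \<beta>" for q
    proof -
      have "b N \<le> q" using q(2) by (simp add: of_rat_less)
      then obtain n where "n \<ge> N" "b n \<le> q" "q < b (Suc n)"
        using q(3) by (rule left_ce_approx_bracket[OF b(1)])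
      with sandwich[OF q(1,3)] N[of n] show ?thesis by fastforce
    qed
    then show "eventually (\<lambda>q. ?f q < y) (rats_at_left \<beta>)"
      unfolding eventually_rats_at_left using b(2)[of N] by blast
  qed
qed

section \<open>From translation functions to approximations\<close>

text \<open>
  The relation \<open>R\<close> stands for \<open>\<le>\<close> or \<open><\<close>. Nonnegativity of \<open>q\<close> is part of the searched
  condition so that the search diverges on negative arguments, as the domain of a translation
  function demands; arguments from \<open>1\<close> on are excluded because \<open>b\<close> stays below \<open>1\<close>.
\<close>

definition first_passage ::
  "(rat \<Rightarrow> rat \<Rightarrow> bool) \<Rightarrow> (nat \<Rightarrow> rat) \<Rightarrow> (nat \<Rightarrow> rat) \<Rightarrow> rat \<rightharpoonup> rat" where
  "first_passage R a b q =
     (if \<exists>n. 0 \<le> q \<and> R q (b n) then Some (a (LEAST n. 0 \<le> q \<and> R q (b n))) else None)"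

lemma partially_computable_first_passage:
  assumes "computable_rat_seq a" "computable_rat_seq b"
    and R: "\<And>f g. recursive f \<Longrightarrow> recursive g \<Longrightarrow>
          decidable (\<lambda>n. R (nat_to_rat_surj (f n)) (nat_to_rat_surj (g n)))"
  shows "partially_computable_rat (first_passage R a b)"
proof -
  obtain f where f: "recursive f" "\<And>n. a n = nat_to_rat_surj (f n)"
    using assms(1) by (auto simp: computable_rat_seq_def recursive_def)
  obtain h where h: "recursive h" "\<And>n. b n = nat_to_rat_surj (h n)"
    using assms(2) by (auto simp: computable_rat_seq_def recursive_def)
  obtain z where z: "nat_to_rat_surj z = 0"
    using surj_nat_to_rat_surj by (metis surjD)
  define P where "P = (\<lambda>c n. 0 \<le> nat_to_rat_surj c \<and> R (nat_to_rat_surj c) (b n))"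
  define s where "s c = (if \<exists>n. P c n then Some (LEAST n. P c n) else None)" for c
  have "decidable (\<lambda>t. P (fst (prod_decode t)) (snd (prod_decode t)))"
    unfolding P_def z[symmetric] h(2)
    by (intro decidable_conj decidable_rat_le R recursive_intros recursive_comp[OF h(1)])
  then have "partial_recursive s"
    unfolding s_def by (rule partial_recursive_Least)
  then have "partial_recursive ((\<lambda>n. Some (f n)) \<circ>\<^sub>m s)"
    using f(1) unfolding recursive_def by (intro partial_recursive.comp)
  moreover have "map_option nat_to_rat_surj (((\<lambda>n. Some (f n)) \<circ>\<^sub>m s) c)
      = first_passage R a b (nat_to_rat_surj c)" for c
    by (simp add: map_comp_def s_def P_def first_passage_def f(2))
  ultimately show ?thesis
    unfolding partially_computable_rat_def by blast
qed

text \<open>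
  The conditions on \<open>R\<close> say that it lies between \<open><\<close> and \<open>\<le>\<close>, which is all that the
  argument uses; the two extreme choices give the two sides of the squeeze.
\<close>

locale first_passage_relation =
  fixes R :: "rat \<Rightarrow> rat \<Rightarrow> bool" and a b :: "nat \<Rightarrow> rat" and \<alpha> \<beta> :: real
  assumes decidable_R: "\<And>f g. recursive f \<Longrightarrow> recursive g \<Longrightarrow>
          decidable (\<lambda>n. R (nat_to_rat_surj (f n)) (nat_to_rat_surj (g n)))"
    and R_le: "R q x \<Longrightarrow> q \<le> x"
    and less_R: "q < x \<Longrightarrow> R q x"
    and a: "left_ce_approx a \<alpha>" and b: "left_ce_approx b \<beta>"
    and a_less: "real_of_rat (a n) < \<alpha>"
    and b_less: "real_of_rat (b n) < \<beta>"
begin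

lemma first_passage_value:
  assumes "q \<in> {0..<1}" "real_of_rat q < \<beta>"
  obtains n where "first_passage R a b q = Some (a n)" "R q (b n)" "\<And>m. R q (b m) \<Longrightarrow> n \<le> m"
proof -
  obtain k where "real_of_rat q < real_of_rat (b k)"
    using left_ce_approx_eventually_greater[OF b assms(2)] by (meson order_refl)
  then have k: "R q (b k)" by (intro less_R) (simp add: of_rat_less)
  show thesis
  proof (rule that[of "LEAST n. R q (b n)"])
    show "first_passage R a b q = Some (a (LEAST n. R q (b n)))"
      using k assms(1) by (auto simp: first_passage_def)
  qed (use k in \<open>auto intro: LeastI Least_le\<close>)
qed

lemma dom_first_passage:
  "dom (first_passage R a b) = {q \<in> {0..<1}. real_of_rat q < \<beta>}"
proof safe
  fix q r assume "first_passage R a b q = Some r"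
  then obtain n where q: "0 \<le> q" "R q (b n)"
    unfolding first_passage_def by (meson option.distinct(1))
  have "b n < 1" using left_ce_approx_range[OF b, of n] by simp
  moreover have "real_of_rat q \<le> real_of_rat (b n)" using R_le[OF q(2)] by (simp add: of_rat_less_eq)
  ultimately show "q \<in> {0..<1}" "real_of_rat q < \<beta>"
    using q R_le[OF q(2)] b_less[of n] by auto
next
  fix q assume "q \<in> {0..<1}" "real_of_rat q < \<beta>"
  then show "\<exists>y. first_passage R a b q = Some y"
    by (rule first_passage_value) blast
qed

lemma nondecreasing_first_passage: "nondecreasing_fun (first_passage R a b)"
  unfolding nondecreasing_fun_def
proof (intro ballI impI)
  fix p q assume p: "p \<in> dom (first_passage R a b)" and q: "q \<in> dom (first_passage R a b)"
    and "p \<le> q"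
  obtain m where m: "first_passage R a b p = Some (a m)" "\<And>k. R p (b k) \<Longrightarrow> m \<le> k"
    using first_passage_value[of p] p unfolding dom_first_passage by auto
  obtain n where n: "first_passage R a b q = Some (a n)" "R q (b n)"
    using first_passage_value[of q] q unfolding dom_first_passage by auto
  \<comment> \<open>For \<open>p < q\<close> the member of \<open>b\<close> found for \<open>q\<close> is strictly above \<open>p\<close>, so the search for
    \<open>p\<close> stops there at the latest.\<close>
  have "R p (b n)"
    using \<open>p \<le> q\<close> n(2) R_le[of q "b n"] less_R[of p "b n"] by (cases "p = q") auto
  then have "a m \<le> a n"
    using m(2) left_ce_approx_mono[OF a] by blast
  then show "the (first_passage R a b p) \<le> the (first_passage R a b q)"
    using m n by simp
qed

lemma translation_first_passage: "translation_function (first_passage R a b) \<beta> \<alpha>"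
  unfolding translation_function_def
proof (intro conjI ballI impI)
  show "dom (first_passage R a b) \<subseteq> {0..<1}" unfolding dom_first_passage by auto
  show "ran (first_passage R a b) \<subseteq> {0..<1}"
    using left_ce_approx_range[OF a] by (force simp: ran_def first_passage_def split: if_splits)
  show "partially_computable_rat (first_passage R a b)"
    using a b by (intro partially_computable_first_passage decidable_R)
      (simp_all add: left_ce_approx_def)
  show "\<exists>r. first_passage R a b q = Some r \<and> real_of_rat r < \<alpha>"
    if "q \<in> {0..<1}" "real_of_rat q < \<beta>" for q
    using that by (rule first_passage_value) (use a_less in auto)
  show "((\<lambda>q. real_of_rat (the (first_passage R a b q))) \<longlongrightarrow> \<alpha>) (rats_at_left \<beta>)"
  proof (rule order_tendstoI)
    fix y assume "y < \<alpha>"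
    then obtain N where N: "\<And>n. n \<ge> N \<Longrightarrow> y < real_of_rat (a n)"
      using left_ce_approx_eventually_greater[OF a] by blast
    have "y < real_of_rat (the (first_passage R a b q))"
      if q: "q \<in> {0..<1}" "real_of_rat (b N) < real_of_rat q" "real_of_rat q < \<beta>" for q
    proof -
      obtain n where n: "first_passage R a b q = Some (a n)" "R q (b n)"
        using q(1,3) by (rule first_passage_value)
      have "b N < b n" using R_le[OF n(2)] q(2) by (simp add: of_rat_less)
      then have "N \<le> n" using left_ce_approx_mono[OF b, of n N] by (cases "N \<le> n") auto
      with N n show ?thesis by simp
    qed
    then show "eventually (\<lambda>q. y < real_of_rat (the (first_passage R a b q))) (rats_at_left \<beta>)"
      unfolding eventually_rats_at_left using b_less[of N] by blast
  next
    fix y assume "\<alpha> < y"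
    have "real_of_rat (the (first_passage R a b q)) < y"
      if "q \<in> {0..<1}" "real_of_rat q < \<beta>" for q
      using that by (rule first_passage_value) (use a_less \<open>\<alpha> < y\<close> in \<open>auto intro: less_trans\<close>)
    then show "eventually (\<lambda>q. real_of_rat (the (first_passage R a b q)) < y) (rats_at_left \<beta>)"
      unfolding eventually_rats_at_left using b_less[of 0] by blast
  qed
qed

end

text \<open>
  At the argument \<open>b n\<close> the search for \<open>\<le>\<close> stops at \<open>n\<close> or earlier (earlier if \<open>b\<close> already had
  this value), and the search for \<open><\<close> stops strictly after \<open>n\<close>. So \<open>a n\<close> lies between the
  two values found.
\<close>

lemma approx_ratio_tendsto:
  assumes lim: "\<And>g. translation_function g \<beta> \<alpha> \<Longrightarrow> nondecreasing_fun g \<Longrightarrow>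
         ((\<lambda>q. (\<alpha> - real_of_rat (the (g q))) / (\<beta> - real_of_rat q)) \<longlongrightarrow> d)
           (rats_at_left \<beta>)"
    and a: "left_ce_approx a \<alpha>" "\<And>n. real_of_rat (a n) < \<alpha>"
    and b: "left_ce_approx b \<beta>" "\<And>n. real_of_rat (b n) < \<beta>"
  shows "(\<lambda>n. (\<alpha> - real_of_rat (a n)) / (\<beta> - real_of_rat (b n))) \<longlonglongrightarrow> d"
proof -
  interpret le: first_passage_relation "(\<le>)" a b \<alpha> \<beta>
    by unfold_locales (use a b decidable_rat_le in auto)
  interpret less: first_passage_relation "(<)" a b \<alpha> \<beta>
    by unfold_locales (use a b decidable_rat_less in auto)
  let ?early = "first_passage (\<le>) a b" and ?late = "first_passage (<) a b"
  note compose = filterlim_compose[OF _ filterlim_rats_at_left[OF b]]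
  have early: "(\<lambda>n. (\<alpha> - real_of_rat (the (?early (b n)))) / (\<beta> - real_of_rat (b n))) \<longlonglongrightarrow> d"
    by (rule compose[OF lim[OF le.translation_first_passage le.nondecreasing_first_passage]])
  have late: "(\<lambda>n. (\<alpha> - real_of_rat (the (?late (b n)))) / (\<beta> - real_of_rat (b n))) \<longlonglongrightarrow> d"
    by (rule compose[OF lim[OF less.translation_first_passage less.nondecreasing_first_passage]])
  have b01: "b n \<in> {0..<1}" for n
    by (rule left_ce_approx_range[OF b(1)])
  have mono: "a m \<le> a n" "b m \<le> b n" if "m \<le> n" for m n
    by (rule left_ce_approx_mono[OF a(1) that], rule left_ce_approx_mono[OF b(1) that])
  have early_le: "the (?early (b n)) \<le> a n" for n
  proof -
    obtain k where "?early (b n) = Some (a k)" "\<And>m. b n \<le> b m \<Longrightarrow> k \<le> m"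
      using le.first_passage_value[OF b01 b(2), of n] by auto
    then show ?thesis using mono(1)[of k n] by simp
  qed
  have late_ge: "a n \<le> the (?late (b n))" for n
  proof -
    obtain k where k: "?late (b n) = Some (a k)" "b n < b k"
      using b01 b(2) by (rule less.first_passage_value)
    have "n \<le> k" using k(2) mono(2)[of k n] by (cases "n \<le> k") auto
    then show ?thesis using k(1) mono(1)[of n k] by simp
  qed
  show ?thesis
  proof (rule tendsto_sandwich[OF _ _ late early]; intro always_eventually allI)
    fix n
    show "(\<alpha> - real_of_rat (the (?late (b n)))) / (\<beta> - real_of_rat (b n))
       \<le> (\<alpha> - real_of_rat (a n)) / (\<beta> - real_of_rat (b n))"
      using late_ge[of n] b(2)[of n] by (intro divide_right_mono) (auto simp: of_rat_less_eq)
    show "(\<alpha> - real_of_rat (a n)) / (\<beta> - real_of_rat (b n))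
       \<le> (\<alpha> - real_of_rat (the (?early (b n)))) / (\<beta> - real_of_rat (b n))"
      using early_le[of n] b(2)[of n] by (intro divide_right_mono) (auto simp: of_rat_less_eq)
  qed
qed

lemma ratio_tendsto_zero_if_reached:
  assumes a: "left_ce_approx a \<alpha>" and N: "real_of_rat (a N) = \<alpha>"
  shows "(\<lambda>n. (\<alpha> - real_of_rat (a n)) / x n) \<longlonglongrightarrow> 0"
proof (rule tendsto_eventually, unfold eventually_sequentially, intro exI[of _ N] allI impI)
  fix n assume "N \<le> n"
  then have "real_of_rat (a N) \<le> real_of_rat (a n)"
    using left_ce_approx_mono[OF a] by (simp add: of_rat_less_eq)
  then show "(\<alpha> - real_of_rat (a n)) / x n = 0"
    using left_ce_approx_le[OF a, of n] N by simp
qed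

text \<open>
  From (ii) to (i), the clause about \<open>d\<close> settles the approximations that reach \<open>\<alpha>\<close>, along
  which every quotient is eventually \<open>0\<close>.
\<close>

theorem proposition1p9:
  fixes \<alpha> \<beta> d :: real
  assumes "\<alpha> \<in> {0..<1}" and "left_ce \<alpha>"
    and "\<beta> \<in> {0..<1}" and "left_ce \<beta>" and "martin_loef_random \<beta>"
    and "d \<ge> 0"
  shows
    "((\<forall>a b. left_ce_approx a \<alpha> \<and> left_ce_approx b \<beta> \<longrightarrow>
         (\<lambda>n. (\<alpha> - real_of_rat (a n)) / (\<beta> - real_of_rat (b n))) \<longlonglongrightarrow> d) \<and>
      (d = 0 \<longleftrightarrow> \<not> martin_loef_random \<alpha>))
     \<longleftrightarrow>
     ((\<forall>g. translation_function g \<beta> \<alpha> \<and> nondecreasing_fun g \<longrightarrow>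
         ((\<lambda>q. (\<alpha> - real_of_rat (the (g q))) / (\<beta> - real_of_rat q)) \<longlongrightarrow> d)
           (rats_at_left \<beta>)) \<and>
      (d = 0 \<longleftrightarrow> \<not> martin_loef_random \<alpha>))"
    (is "?approx \<and> ?zero \<longleftrightarrow> ?transl \<and> ?zero")
proof -
  note b_less = left_ce_approx_less_random[OF _ assms(5)]
  have "?transl" if approx: ?approx
  proof -
    obtain b where b: "left_ce_approx b \<beta>" using assms(4) by (auto simp: left_ce_def)
    show ?thesis
    proof (intro allI impI, elim conjE)
      fix g assume "translation_function g \<beta> \<alpha>" "nondecreasing_fun g"
      then show "((\<lambda>q. (\<alpha> - real_of_rat (the (g q))) / (\<beta> - real_of_rat q)) \<longlongrightarrow> d)
          (rats_at_left \<beta>)"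
        using translation_ratio_tendsto[OF _ _ _ b b_less[OF b]] approx by simp
    qed
  qed
  moreover have "?approx" if transl: ?transl and zero: ?zero
  proof (intro allI impI, elim conjE)
    fix a b assume a: "left_ce_approx a \<alpha>" and b: "left_ce_approx b \<beta>"
    show "(\<lambda>n. (\<alpha> - real_of_rat (a n)) / (\<beta> - real_of_rat (b n))) \<longlonglongrightarrow> d"
    proof (cases "\<exists>N. real_of_rat (a N) = \<alpha>")
      case True
      then have "d = 0" using zero not_martin_loef_random_of_rat by auto
      moreover obtain N where "real_of_rat (a N) = \<alpha>" using True by blast
      ultimately show ?thesis using ratio_tendsto_zero_if_reached[OF a] by simp
    next
      case False
      have "real_of_rat (a n) < \<alpha>" for n
        using False left_ce_approx_le[OF a, of n] by (simp add: less_le)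
      then show ?thesis
        using approx_ratio_tendsto[OF _ a _ b b_less[OF b]] transl by simp
    qed
  qed
  ultimately show ?thesis by blast
qed

end
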